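(* Let $\alpha$ be the order of the class $\mathcal{S}_H$ of normalized sense-preserving univalent harmonic functions in the unit disk $\mathbb{D}$. If $f\in\mathcal{S}_H$, then the following statements hold: (i) $f$ is in the harmonic Bergman space $a^p$ for all $0<p<1/\alpha$. (ii) The analytic functions $f_z,\ \overline{f_{\bar z}}$ belong to the Bergman space $A^q$, and the harmonic functions $f_\theta,\ r f_r$ belong to $a^q$, for all $0<q<1/(\alpha+1)$.
   Context: $\mathbb{D}$ is the open unit disk in $\mathbb{C}$ and $dA(z)=\frac{1}{\pi}\,dx\,dy$ is the normalized area measure on $\mathbb{D}$. A complex-valued function on $\mathbb{D}$ is harmonic if its real and imaginary parts are harmonic; it has a unique representation $f=h+\overline{g}$ with $h,g$ analytic in $\mathbb{D}$ and $g(0)=0$. Put $\|f\|_p:=\left(\int_{\mathbb{D}}|f(z)|^p\,dA(z)\right)^{1/p}$ for $0<p<\infty$. The Bergman space $A^p$ is the set of analytic $f$ in $\mathbb{D}$ with $\|f\|_p<\infty$; the harmonic Bergman space $a^p$ is the set of complex-valued harmonic $f$ in $\mathbb{D}$ with $\|f\|_p<\infty$. $\mathcal{S}_H$ is the class of all sense-preserving univalent (injective) harmonic functions $f=h+\overline{g}$ in $\mathbb{D}$ with the normalizations $h(0)=g(0)=h'(0)-1=0$. The order of $\mathcal{S}_H$ is $\alpha:=\sup_{f\in\mathcal{S}_H}\left|\frac{h''(0)}{2}\right|$. For $z=re^{i\theta}\in\mathbb{D}$, $f_\theta$ and $f_r$ denote the partial derivatives of $f(re^{i\theta})$ with respect to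 $\theta$ and $r$, and $f_z$, $f_{\bar z}$ are the Wirtinger derivatives, so that $f_z=h'$ and $\overline{f_{\bar z}}=g'$. *)

theory Defs
  imports "HOL-Complex_Analysis.Complex_Analysis"
begin

abbreviation unit_disk :: "complex set" ("\<DD>") where
  "\<DD> \<equiv> ball 0 1"

text \<open>Normalized area measure. The underlying space is the disk itself, so values of a function
  outside the disk affect neither its measurability nor its integral.\<close>

definition area_measure :: "complex measure" where
  "area_measure = scale_measure (ennreal (1 / pi)) (restrict_space lborel \<DD>)"


subsection \<open>Partial derivatives and harmonic functions\<close>

definition partial_x :: "(complex \<Rightarrow> 'a::real_normed_vector) \<Rightarrow> complex \<Rightarrow> 'a" where
  "partial_x f z = vector_derivative (\<lambda>t. f (z + complex_of_real t)) (at 0)"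

definition partial_y :: "(complex \<Rightarrow> 'a::real_normed_vector) \<Rightarrow> complex \<Rightarrow> 'a" where
  "partial_y f z = vector_derivative (\<lambda>t. f (z + \<i> * complex_of_real t)) (at 0)"

text \<open>The following notions are meant for open sets \<open>S\<close>. Real differentiability is demanded
  explicitly because \<^const>\<open>vector_derivative\<close> is unspecified where no derivative exists.\<close>

definition C1_on :: "complex set \<Rightarrow> (complex \<Rightarrow> real) \<Rightarrow> bool" where
  "C1_on S u \<longleftrightarrow> (\<forall>z\<in>S. u differentiable (at z)) \<and>
     continuous_on S (partial_x u) \<and> continuous_on S (partial_y u)"

definition C2_on :: "complex set \<Rightarrow> (complex \<Rightarrow> real) \<Rightarrow> bool" where
  "C2_on S u \<longleftrightarrow> C1_on S u \<and> C1_on S (partial_x u) \<and> C1_on S (partial_y u)"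

definition real_harmonic_on :: "complex set \<Rightarrow> (complex \<Rightarrow> real) \<Rightarrow> bool" where
  "real_harmonic_on S u \<longleftrightarrow> C2_on S u \<and>
     (\<forall>z\<in>S. partial_x (partial_x u) z + partial_y (partial_y u) z = 0)"

definition harmonic_on :: "complex set \<Rightarrow> (complex \<Rightarrow> complex) \<Rightarrow> bool" where
  "harmonic_on S f \<longleftrightarrow>
     real_harmonic_on S (\<lambda>z. Re (f z)) \<and> real_harmonic_on S (\<lambda>z. Im (f z))"

definition wirtinger_z :: "(complex \<Rightarrow> complex) \<Rightarrow> complex \<Rightarrow> complex" where
  "wirtinger_z f z = (partial_x f z - \<i> * partial_y f z) / 2"

definition wirtinger_zbar :: "(complex \<Rightarrow> complex) \<Rightarrow> complex \<Rightarrow> complex" where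
  "wirtinger_zbar f z = (partial_x f z + \<i> * partial_y f z) / 2"

text \<open>Derivatives of \<open>f (r e\<^sup>i\<^sup>\<theta>)\<close> in \<open>\<theta>\<close> and \<open>r\<close>, taken at \<open>r = cmod z\<close> and \<open>\<theta> = Arg z\<close>.
  For \<open>z \<noteq> 0\<close> the result does not depend on the branch of the argument. At \<open>z = 0\<close> one has
  \<open>Arg 0 = 0\<close>: the angular derivative is \<open>0\<close>, while the radial one depends on this choice and
  will only be used multiplied by \<open>r = 0\<close>.\<close>

definition partial_theta :: "(complex \<Rightarrow> complex) \<Rightarrow> complex \<Rightarrow> complex" where
  "partial_theta f z = vector_derivative (\<lambda>t. f (rcis (cmod z) t)) (at (Arg z))"

definition partial_r :: "(complex \<Rightarrow> complex) \<Rightarrow> complex \<Rightarrow> complex" where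
  "partial_r f z = vector_derivative (\<lambda>r. f (rcis r (Arg z))) (at (cmod z))"


subsection \<open>Bergman spaces\<close>

definition bergman_norm :: "real \<Rightarrow> (complex \<Rightarrow> complex) \<Rightarrow> ennreal" where
  "bergman_norm p f =
     (let I = (\<integral>\<^sup>+ z. ennreal (cmod (f z) powr p) \<partial>area_measure)
      in if I = \<infinity> then \<infinity> else ennreal (enn2real I powr (1 / p)))"

definition bergman :: "real \<Rightarrow> (complex \<Rightarrow> complex) set" where
  "bergman p = {f. f holomorphic_on \<DD> \<and> bergman_norm p f < \<infinity>}"

definition harmonic_bergman :: "real \<Rightarrow> (complex \<Rightarrow> complex) set" where
  "harmonic_bergman p = {f. harmonic_on \<DD> f \<and> bergman_norm p f < \<infinity>}"


subsection \<open>Normalized univalent harmonic functions\<close>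

definition canonical_rep ::
  "(complex \<Rightarrow> complex) \<Rightarrow> (complex \<Rightarrow> complex) \<Rightarrow> (complex \<Rightarrow> complex) \<Rightarrow> bool" where
  "canonical_rep f h g \<longleftrightarrow> h holomorphic_on \<DD> \<and> g holomorphic_on \<DD> \<and> g 0 = 0 \<and>
     (\<forall>z\<in>\<DD>. f z = h z + cnj (g z))"

text \<open>Sense-preserving means that the Jacobian \<open>\<bar>f\<^sub>z\<bar>\<^sup>2 - \<bar>f\<^sub>z\<^sub>b\<^sub>a\<^sub>r\<bar>\<^sup>2\<close> is positive.\<close>

definition sense_preserving_on :: "complex set \<Rightarrow> (complex \<Rightarrow> complex) \<Rightarrow> bool" where
  "sense_preserving_on S f \<longleftrightarrow>
     (\<forall>z\<in>S. (cmod (wirtinger_z f z))\<^sup>2 - (cmod (wirtinger_zbar f z))\<^sup>2 > 0)"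

definition S_H :: "(complex \<Rightarrow> complex) set" where
  "S_H = {f. harmonic_on \<DD> f \<and> inj_on f \<DD> \<and> sense_preserving_on \<DD> f \<and>
     (\<exists>h g. canonical_rep f h g \<and> h 0 = 0 \<and> deriv h 0 = 1)}"

text \<open>The supremum is taken in the extended reals, so it exists without any boundedness result.\<close>

definition order_S_H :: ereal where
  "order_S_H =
     Sup {ereal (cmod (deriv (deriv h) 0 / 2)) | f h g. f \<in> S_H \<and> canonical_rep f h g}"

end

(* The Koebe transforms F(z) = (f((z + a) / (1 + cnj a z)) - f(a)) / ((1 - |a|^2) h'(a)) of a member
   f = h + cnj g of S_H stay in S_H. Bounding their second coefficients by the order A gives
   |h''(a) / h'(a)| <= 2 (A + |a|) / (1 - |a|^2). Integrating this along radii yields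
   |g'(z)| < |h'(z)| <= C (1 - |z|)^(-A-1), and a second integration |f(z)| <= C (1 - |z|)^(-A)
   if A > 0. Finally (1 - |z|)^(-s) is integrable over the disk for s < 1. *)

theory Submission
  imports Defs
begin

section \<open>Real derivatives and derivatives along curves\<close>

lemma has_derivative_holomorphic_plus_cnj:
  assumes "open S" "h holomorphic_on S" "g holomorphic_on S" "\<And>z. z \<in> S \<Longrightarrow> f z = h z + cnj (g z)" "z \<in> S"
  shows "(f has_derivative (\<lambda>v. deriv h z * v + cnj (deriv g z * v))) (at z)"
proof (rule has_derivative_transform_within_open[OF _ \<open>open S\<close> \<open>z \<in> S\<close>])
  have h: "(h has_derivative (\<lambda>v. deriv h z * v)) (at z)"
    and g: "(g has_derivative (\<lambda>v. deriv g z * v)) (at z)"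
    using holomorphic_derivI[OF assms(2,1,5)] holomorphic_derivI[OF assms(3,1,5)]
    by (simp_all add: has_field_derivative_def)
  show "((\<lambda>z. h z + cnj (g z)) has_derivative (\<lambda>v. deriv h z * v + cnj (deriv g z * v))) (at z)"
    by (intro has_derivative_add h has_derivative_cnj g)
qed (use assms in auto)

text \<open>Each Cartesian or polar partial derivative is a derivative of \<open>f\<close> along a
  curve, so this form of the chain rule computes all of them from the real derivative of
  \<open>f\<close>.\<close>

lemma has_vector_derivative_has_derivative_compose:
  assumes "(\<gamma> has_vector_derivative v) (at t)" "(f has_derivative D) (at (\<gamma> t))"
  shows "((\<lambda>s. f (\<gamma> s)) has_vector_derivative D v) (at t)"
  using vector_derivative_diff_chain_within[of \<gamma> v t UNIV f D] assms
  by (auto simp: o_def intro: has_derivative_at_withinI)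

lemma partial_x_eq:
  assumes "(f has_derivative D) (at z)"
  shows "partial_x f z = D 1"
proof -
  have "((\<lambda>t. z + complex_of_real t) has_vector_derivative 1) (at 0)"
    by (auto intro!: derivative_eq_intros simp: has_vector_derivative_def scaleR_conv_of_real)
  from has_vector_derivative_has_derivative_compose[OF this] show ?thesis
    unfolding partial_x_def using assms by (intro vector_derivative_at) auto
qed

lemma partial_y_eq:
  assumes "(f has_derivative D) (at z)"
  shows "partial_y f z = D \<i>"
proof -
  have "((\<lambda>t. z + \<i> * complex_of_real t) has_vector_derivative \<i>) (at 0)"
    by (auto intro!: derivative_eq_intros simp: has_vector_derivative_def scaleR_conv_of_real)
  from has_vector_derivative_has_derivative_compose[OF this] show ?thesis
    unfolding partial_y_def using assms by (intro vector_derivative_at) auto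
qed

section \<open>Harmonicity of \<open>h + cnj g\<close>\<close>

context
  fixes S :: "complex set" and k :: "complex \<Rightarrow> complex" and u :: "complex \<Rightarrow> real"
  assumes S: "open S" and k: "k holomorphic_on S" and u: "\<And>z. z \<in> S \<Longrightarrow> u z = Re (k z)"
begin

lemma has_derivative_Re_holomorphic:
  assumes "z \<in> S"
  shows "(u has_derivative (\<lambda>v. Re (deriv k z * v))) (at z)"
proof (rule has_derivative_transform_within_open[OF _ S assms])
  have "(k has_derivative (\<lambda>v. deriv k z * v)) (at z)"
    using holomorphic_derivI[OF k S assms] by (simp add: has_field_derivative_def)
  then show "((\<lambda>z. Re (k z)) has_derivative (\<lambda>v. Re (deriv k z * v))) (at z)"
    by (rule has_derivative_Re)
qed (use u in auto)

lemma partial_Re_holomorphic: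
  assumes "z \<in> S"
  shows "partial_x u z = Re (deriv k z)" "partial_y u z = Re (\<i> * deriv k z)"
  using partial_x_eq[OF has_derivative_Re_holomorphic[OF assms]]
    partial_y_eq[OF has_derivative_Re_holomorphic[OF assms]] by auto

lemma C1_on_Re_holomorphic: "C1_on S u"
proof -
  have c: "continuous_on S (deriv k)"
    using holomorphic_deriv[OF k S] by (rule holomorphic_on_imp_continuous_on)
  have "continuous_on S (partial_x u)"
    by (subst continuous_on_cong[OF refl partial_Re_holomorphic(1)]) (assumption, intro continuous_intros c)
  moreover have "continuous_on S (partial_y u)"
    by (subst continuous_on_cong[OF refl partial_Re_holomorphic(2)]) (assumption, intro continuous_intros c)
  ultimately show ?thesis
    unfolding C1_on_def using has_derivative_Re_holomorphic by (auto simp: differentiable_def)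
qed

end

text \<open>The first partial derivatives of \<open>u\<close> are the real parts of
  \<open>deriv k\<close> and \<open>\<i> * deriv k\<close>, which are again holomorphic, so the
  first-order facts apply a second time. The two second derivatives are real parts of
  \<open>deriv (deriv k)\<close> and its negative. Agreement of \<open>u\<close> with
  \<open>Re k\<close> is asked for on \<open>S\<close> only, because that is where
  \<open>partial_x u\<close> and \<open>partial_y u\<close> are known.\<close>

lemma real_harmonic_on_Re_holomorphic:
  assumes S: "open S" and k: "k holomorphic_on S" and u: "\<And>z. z \<in> S \<Longrightarrow> u z = Re (k z)"
  shows "real_harmonic_on S u"
proof -
  have k': "deriv k holomorphic_on S" by (rule holomorphic_deriv[OF k S])
  then have ik': "(\<lambda>z. \<i> * deriv k z) holomorphic_on S"
    by (intro holomorphic_on_mult holomorphic_on_const)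
  note p = partial_Re_holomorphic[OF S k u]
  have d: "deriv (\<lambda>z. \<i> * deriv k z) z = \<i> * deriv (deriv k) z" if "z \<in> S" for z
    using holomorphic_on_imp_differentiable_at[OF k' S that] by simp
  show ?thesis
    unfolding real_harmonic_on_def C2_on_def
    using C1_on_Re_holomorphic[OF S k u] C1_on_Re_holomorphic[OF S k' p(1)]
      C1_on_Re_holomorphic[OF S ik' p(2)]
      partial_Re_holomorphic(1)[OF S k' p(1)] partial_Re_holomorphic(2)[OF S ik' p(2)] d
    by auto
qed

text \<open>Conjugation only flips the sign of \<open>Im (g z)\<close>, so the real and imaginary
  parts of \<open>f\<close> are the real parts of the holomorphic functions \<open>h + g\<close> and
  \<open>- \<i> * (h - g)\<close>.\<close>

lemma harmonic_on_holomorphic_plus_cnj: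
  assumes S: "open S" and hg: "h holomorphic_on S" "g holomorphic_on S"
    and f: "\<And>z. z \<in> S \<Longrightarrow> f z = h z + cnj (g z)"
  shows "harmonic_on S f"
  unfolding harmonic_on_def
proof
  show "real_harmonic_on S (\<lambda>z. Re (f z))"
    by (rule real_harmonic_on_Re_holomorphic[where k = "\<lambda>z. h z + g z"])
      (use assms in \<open>auto intro!: holomorphic_intros\<close>)
  show "real_harmonic_on S (\<lambda>z. Im (f z))"
    by (rule real_harmonic_on_Re_holomorphic[where k = "\<lambda>z. - \<i> * (h z - g z)"])
      (use assms in \<open>auto intro!: holomorphic_intros\<close>)
qed

section \<open>Wirtinger and polar derivatives of \<open>h + cnj g\<close>\<close>

context
  fixes f h g :: "complex \<Rightarrow> complex"
  assumes rep: "canonical_rep f h g"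
begin

lemma canonical_rep_has_derivative:
  assumes "z \<in> \<DD>"
  shows "(f has_derivative (\<lambda>v. deriv h z * v + cnj (deriv g z * v))) (at z)"
  using rep assms unfolding canonical_rep_def
  by (intro has_derivative_holomorphic_plus_cnj[of \<DD>]) auto

lemma canonical_rep_wirtinger:
  assumes "z \<in> \<DD>"
  shows "wirtinger_z f z = deriv h z" "wirtinger_zbar f z = cnj (deriv g z)"
  using partial_x_eq[OF canonical_rep_has_derivative[OF assms]]
    partial_y_eq[OF canonical_rep_has_derivative[OF assms]]
  by (auto simp: wirtinger_z_def wirtinger_zbar_def complex_eq_iff)

text \<open>The circle through \<open>z\<close> has velocity \<open>\<i> * z\<close> at the angle
  \<open>Arg z\<close>. This includes \<open>z = 0\<close>, where the circle is a point.\<close>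

lemma canonical_rep_partial_theta:
  assumes "z \<in> \<DD>"
  shows "partial_theta f z = \<i> * z * deriv h z + cnj (\<i> * z * deriv g z)"
proof -
  note z = rcis_cmod_Arg[of z]
  have D: "(f has_derivative (\<lambda>v. deriv h z * v + cnj (deriv g z * v))) (at (rcis (cmod z) (Arg z)))"
    using canonical_rep_has_derivative[OF assms] z by simp
  have "((\<lambda>t. rcis (cmod z) t) has_vector_derivative of_real (cmod z) * (\<i> * cis (Arg z))) (at (Arg z))"
    unfolding rcis_def has_vector_derivative_def
    by (auto intro!: derivative_eq_intros simp: scaleR_conv_of_real)
  also have "of_real (cmod z) * (\<i> * cis (Arg z)) = \<i> * z"
    using z unfolding rcis_def by (metis mult.left_commute)
  finally have "((\<lambda>t. rcis (cmod z) t) has_vector_derivative \<i> * z) (at (Arg z))" .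
  from has_vector_derivative_has_derivative_compose[OF this, OF D]
  have "((\<lambda>t. f (rcis (cmod z) t)) has_vector_derivative
      deriv h z * (\<i> * z) + cnj (deriv g z * (\<i> * z))) (at (Arg z))" .
  then show ?thesis
    unfolding partial_theta_def by (subst vector_derivative_at) (auto simp: mult_ac)
qed

text \<open>The ray through \<open>z\<close> has velocity \<open>cis (Arg z)\<close>, and the factor
  \<open>cmod z\<close> turns this into \<open>z\<close>. At the origin it also removes the
  dependence on the value of \<open>Arg 0\<close>.\<close>

lemma canonical_rep_partial_r:
  assumes "z \<in> \<DD>"
  shows "of_real (cmod z) * partial_r f z = z * deriv h z + cnj (z * deriv g z)"
proof -
  note z = rcis_cmod_Arg[of z]
  have D: "(f has_derivative (\<lambda>v. deriv h z * v + cnj (deriv g z * v))) (at (rcis (cmod z) (Arg z)))"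
    using canonical_rep_has_derivative[OF assms] z by simp
  have "((\<lambda>r. rcis r (Arg z)) has_vector_derivative cis (Arg z)) (at (cmod z))"
    unfolding rcis_def has_vector_derivative_def
    by (auto intro!: derivative_eq_intros simp: scaleR_conv_of_real)
  from has_vector_derivative_has_derivative_compose[OF this, OF D]
  have "((\<lambda>r. f (rcis r (Arg z))) has_vector_derivative
      deriv h z * cis (Arg z) + cnj (deriv g z * cis (Arg z))) (at (cmod z))" .
  then have "partial_r f z = deriv h z * cis (Arg z) + cnj (deriv g z * cis (Arg z))"
    unfolding partial_r_def by (rule vector_derivative_at)
  then have "of_real (cmod z) * partial_r f z =
      deriv h z * rcis (cmod z) (Arg z) + cnj (deriv g z * rcis (cmod z) (Arg z))"
    by (simp add: rcis_def algebra_simps)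
  then show ?thesis by (simp only: z mult_ac)
qed

end

section \<open>Integration along radii\<close>

text \<open>Mean value inequality with a majorant on the segment from 0 to \<open>z\<close>. It
  serves for both integrations: of the logarithmic derivative of \<open>deriv h\<close>, and of the
  derivatives of \<open>h\<close> and \<open>g\<close>.\<close>

lemma disk_radial_bound:
  fixes L :: "complex \<Rightarrow> complex" and \<phi> \<phi>' :: "real \<Rightarrow> real"
  assumes L: "L holomorphic_on \<DD>"
    and \<phi>: "\<And>t. 0 \<le> t \<Longrightarrow> t < 1 \<Longrightarrow> (\<phi> has_real_derivative \<phi>' t) (at t)"
    and bound: "\<And>z. z \<in> \<DD> \<Longrightarrow> cmod (deriv L z) \<le> \<phi>' (cmod z)"
    and z: "z \<in> \<DD>"
  shows "cmod (L z - L 0) \<le> \<phi> (cmod z) - \<phi> 0"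
proof (cases "z = 0")
  case False
  define u where "u = sgn z"
  have u: "cmod u = 1" "z = of_real (cmod z) * u"
    using False by (auto simp: u_def norm_sgn) (simp add: sgn_eq)
  have tu: "of_real t * u \<in> \<DD>" if "0 \<le> t" "t < 1" for t
    using that u(1) by (simp add: norm_mult)
  have "(L has_derivative (\<lambda>v. deriv L (of_real t * u) * v)) (at (of_real t * u))"
    if "0 \<le> t" "t < 1" for t
    using holomorphic_derivI[OF L _ tu[OF that]] by (simp add: has_field_derivative_def)
  moreover have "((\<lambda>t. of_real t * u) has_vector_derivative u) (at t)" for t
    by (auto intro!: derivative_eq_intros simp: has_vector_derivative_def scaleR_conv_of_real)
  ultimately have dL: "((\<lambda>t. L (of_real t * u)) has_vector_derivative deriv L (of_real t * u) * u) (at t)"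
    if "0 \<le> t" "t < 1" for t
    using has_vector_derivative_has_derivative_compose[of "\<lambda>t. of_real t * u" u t L
        "\<lambda>v. deriv L (of_real t * u) * v"] that by simp
  have z1: "cmod z < 1" using z by simp
  have "cmod (L (of_real (cmod z) * u) - L (of_real 0 * u)) \<le> \<phi> (cmod z) - \<phi> 0"
  proof (rule differentiable_bound_general[where \<phi>' = \<phi>' and f' = "\<lambda>t. deriv L (of_real t * u) * u"])
    show "continuous_on {0..cmod z} (\<lambda>t. L (of_real t * u))"
      using dL z1 by (intro continuous_at_imp_continuous_on) (auto intro!: has_vector_derivative_continuous[OF dL])
    show "continuous_on {0..cmod z} \<phi>"
      using \<phi> z1 by (intro continuous_at_imp_continuous_on) (auto intro!: DERIV_isCont[OF \<phi>])
    fix t assume t: "0 < t" "t < cmod z"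
    show "((\<lambda>t. L (of_real t * u)) has_vector_derivative deriv L (of_real t * u) * u) (at t)"
      using dL t z1 by simp
    show "(\<phi> has_vector_derivative \<phi>' t) (at t)"
      using \<phi> t z1 by (simp add: has_real_derivative_iff_has_vector_derivative)
    show "cmod (deriv L (of_real t * u) * u) \<le> \<phi>' t"
      using bound[OF tu[of t]] t z1 u(1) by (simp add: norm_mult)
  qed (use False in auto)
  then show ?thesis using u(2) by simp
qed simp

section \<open>Area integrals and finiteness of the Bergman norm\<close>

lemma borel_measurable_area_measure:
  assumes "F \<in> borel_measurable borel"
  shows "F \<in> borel_measurable area_measure"
  unfolding area_measure_def measurable_cong_sets[OF sets_scale_measure refl]
  using assms by (intro measurable_restrict_space1) simp

lemma nn_integral_area_measure:
  assumes "F \<in> borel_measurable borel"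
  shows "(\<integral>\<^sup>+ z. F z \<partial>area_measure) = ennreal (1 / pi) * (\<integral>\<^sup>+ z. F z * indicator \<DD> z \<partial>lborel)"
proof -
  have "F \<in> borel_measurable (restrict_space lborel \<DD>)"
    using assms by (intro measurable_restrict_space1) simp
  then show ?thesis
    unfolding area_measure_def by (simp add: nn_integral_scale_measure nn_integral_restrict_space)
qed

lemma space_area_measure: "space area_measure = \<DD>"
  by (simp add: area_measure_def space_scale_measure space_restrict_space)

text \<open>The exact area is \<open>pi * (1 - \<rho>\<^sup>2)\<close>, and
  \<open>1 + \<rho> \<le> 2\<close> leaves a bound linear in the width.\<close>

lemma emeasure_lborel_annulus_le:
  assumes "0 \<le> \<rho>" "\<rho> \<le> 1"
  shows "emeasure lborel (\<DD> - ball (0::complex) \<rho>) \<le> ennreal (2 * pi * (1 - \<rho>))"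
proof -
  have "emeasure lborel (\<DD> - ball (0::complex) \<rho>)
      = emeasure lborel \<DD> - emeasure lborel (ball (0::complex) \<rho>)"
    using assms by (intro emeasure_Diff) (auto simp: emeasure_ball)
  also have "\<dots> = ennreal (pi * (1 - \<rho>\<^sup>2))"
    using assms by (simp add: emeasure_ball unit_ball_vol_2 ennreal_minus algebra_simps)
  also have "\<dots> \<le> ennreal (2 * pi * (1 - \<rho>))"
  proof (rule ennreal_leI)
    have "1 - \<rho>\<^sup>2 = (1 + \<rho>) * (1 - \<rho>)" by (simp add: algebra_simps power2_eq_square)
    also have "\<dots> \<le> 2 * (1 - \<rho>)" using assms by (intro mult_right_mono) auto
    finally show "pi * (1 - \<rho>\<^sup>2) \<le> 2 * pi * (1 - \<rho>)" by simp
  qed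
  finally show ?thesis .
qed

text \<open>The least exponent \<open>m\<close> with \<open>(1/2) ^ m < x\<close> is positive
  because \<open>x \<le> 1\<close>, and its predecessor is the required \<open>n\<close>.\<close>

lemma dyadic_bracket:
  fixes x :: real
  assumes "0 < x" "x \<le> 1"
  obtains n :: nat where "(1/2) ^ Suc n < x" "x \<le> (1/2) ^ n"
proof -
  have ex: "\<exists>n. (1/2::real) ^ n < x" using assms by (intro real_arch_pow_inv) auto
  define m where "m = (LEAST n. (1/2::real) ^ n < x)"
  have m: "(1/2) ^ m < x" unfolding m_def using ex by (rule LeastI_ex)
  then have "m \<noteq> 0" using assms(2) by (intro notI) simp
  then obtain n where n: "m = Suc n" by (cases m) auto
  then have "\<not> (1/2) ^ n < x" using not_less_Least[of n "\<lambda>n. (1/2) ^ n < x"] by (simp flip: m_def)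
  with m n that show thesis by (simp add: not_less)
qed

text \<open>Dyadic decomposition by the distance to the circle: at distance about
  \<open>(1/2) ^ n\<close> the integrand is at most a multiple of \<open>2 powr (s * n)\<close> and
  the area at most a multiple of \<open>(1/2) ^ n\<close>, which leaves a geometric series.\<close>

lemma nn_integral_boundary_distance_powr:
  assumes s: "s < 1" "0 \<le> s"
  shows "(\<integral>\<^sup>+ z. ennreal ((1 - cmod z) powr (- s)) \<partial>area_measure) < \<infinity>"
proof -
  \<comment> \<open>These annuli all reach to the unit circle and are nested; the overlaps only
    enlarge the upper bound.\<close>
  define E where "E n = \<DD> - ball (0::complex) (1 - (1/2) ^ n)" for n :: nat
  \<comment> \<open>The value of the integrand at the distance \<open>(1/2) ^ Suc n\<close>, the
    lower end of the dyadic bracket.\<close>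
  define c where "c n = (2::real) powr (s * real (Suc n))" for n :: nat
  have [measurable]: "E n \<in> sets borel" for n by (simp add: E_def)
  have "(\<integral>\<^sup>+ z. ennreal ((1 - cmod z) powr (- s)) * indicator \<DD> z \<partial>lborel)
      \<le> (\<integral>\<^sup>+ z. (\<Sum>n. ennreal (c n) * indicator (E n) z) \<partial>lborel)"
  proof (rule nn_integral_mono)
    fix z :: complex
    show "ennreal ((1 - cmod z) powr (- s)) * indicator \<DD> z \<le> (\<Sum>n. ennreal (c n) * indicator (E n) z)"
    proof (cases "z \<in> \<DD>")
      case True
      then obtain n where n: "(1/2) ^ Suc n < 1 - cmod z" "1 - cmod z \<le> (1/2) ^ n"
        using dyadic_bracket[of "1 - cmod z"] by auto
      have "(1 - cmod z) powr (- s) \<le> ((1/2) ^ Suc n) powr (- s)"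
        using n s by (intro powr_mono2') auto
      also have "((1/2::real) ^ Suc n) = 2 powr (- real (Suc n))"
        by (simp only: powr_minus powr_realpow zero_less_numeral) (simp add: power_one_over inverse_eq_divide)
      also have "(2 powr (- real (Suc n))) powr (- s) = c n"
        by (simp add: powr_powr c_def algebra_simps)
      finally have le: "(1 - cmod z) powr (- s) \<le> c n" .
      have "z \<in> E n" using True n by (auto simp: E_def)
      then have "ennreal ((1 - cmod z) powr (- s)) * indicator \<DD> z \<le> ennreal (c n) * indicator (E n) z"
        using True le by (simp add: ennreal_leI)
      \<comment> \<open>Written as a sum over a singleton, the one relevant term can be compared
        with the whole series.\<close>
      also have "\<dots> = sum (\<lambda>n. ennreal (c n) * indicator (E n) z) {n}"
        by (simp only: sum.insert sum.empty finite.emptyI empty_iff not_False_eq_True add_0_right)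
      also have "\<dots> \<le> (\<Sum>n. ennreal (c n) * indicator (E n) z)"
        by (intro sum_le_suminf) auto
      finally show ?thesis .
    qed simp
  qed
  also have "\<dots> = (\<Sum>n. ennreal (c n) * emeasure lborel (E n))"
    by (subst nn_integral_suminf) (auto simp: nn_integral_cmult_indicator)
  also have "\<dots> \<le> (\<Sum>n. ennreal (2 * pi * 2 powr s * (2 powr (s - 1)) ^ n))"
  proof (intro suminf_le)
    fix n
    have "ennreal (c n) * emeasure lborel (E n) \<le> ennreal (c n) * ennreal (2 * pi * (1 - (1 - (1/2) ^ n)))"
      unfolding E_def by (intro mult_left_mono emeasure_lborel_annulus_le) (auto simp: power_le_one)
    also have "\<dots> = ennreal (c n * (2 * pi * (1/2) ^ n))"
      by (simp add: c_def ennreal_mult)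
    also have "c n * (2 * pi * (1/2) ^ n) = 2 * pi * 2 powr s * (2 powr (s - 1)) ^ n"
    proof -
      have "(1/2::real) ^ n = 2 powr (- real n)"
        by (simp add: powr_minus powr_realpow power_one_over inverse_eq_divide)
      moreover have "(2 powr (s - 1)) ^ n = 2 powr ((s - 1) * real n)"
        by (simp add: powr_powr flip: powr_realpow)
      moreover have "2 powr (s * real (Suc n)) * 2 powr (- real n) = 2 powr s * 2 powr ((s - 1) * real n)"
        by (simp flip: powr_add add: algebra_simps)
      ultimately show ?thesis by (simp add: c_def)
    qed
    finally show "ennreal (c n) * emeasure lborel (E n) \<le> ennreal (2 * pi * 2 powr s * (2 powr (s - 1)) ^ n)" .
  qed auto
  also have "\<dots> < \<infinity>"
  proof -
    \<comment> \<open>The ratio of the geometric series is below 1 exactly because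
      \<open>s < 1\<close>.\<close>
    have "(2::real) powr (s - 1) < 2 powr 0" using s by (intro powr_less_mono) auto
    then have "summable (\<lambda>n. 2 * pi * 2 powr s * (2 powr (s - 1)) ^ n)"
      by (intro summable_mult summable_geometric) simp
    then show ?thesis by (simp add: ennreal_suminf_neq_top less_top[symmetric])
  qed
  finally show ?thesis
    by (subst nn_integral_area_measure) (auto simp: ennreal_mult_less_top)
qed

lemma bergman_norm_less_infinity_iff:
  "bergman_norm p f < \<infinity> \<longleftrightarrow> (\<integral>\<^sup>+ z. ennreal (cmod (f z) powr p) \<partial>area_measure) < \<infinity>"
  by (cases "(\<integral>\<^sup>+ z. ennreal (cmod (f z) powr p) \<partial>area_measure) = \<infinity>")
    (simp_all add: bergman_norm_def Let_def less_top[symmetric])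

text \<open>The \<open>p\<close>-th power of the growth bound is a constant times
  \<open>(1 - cmod z) powr (- (p * A))\<close>, which is integrable since
  \<open>p * A < 1\<close>.\<close>

lemma bergman_norm_finite_if_growth:
  assumes p: "0 < p" and A: "0 \<le> A" "p * A < 1" and K: "0 \<le> K"
    and growth: "\<And>z. z \<in> \<DD> \<Longrightarrow> cmod (f z) \<le> K * (1 - cmod z) powr (- A)"
  shows "bergman_norm p f < \<infinity>"
proof -
  have "(\<integral>\<^sup>+ z. ennreal (cmod (f z) powr p) \<partial>area_measure)
      \<le> (\<integral>\<^sup>+ z. ennreal (K powr p) * ennreal ((1 - cmod z) powr (- (p * A))) \<partial>area_measure)"
  proof (rule nn_integral_mono)
    fix z assume "z \<in> space area_measure"
    then have z: "z \<in> \<DD>" by (simp add: space_area_measure)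
    have "cmod (f z) powr p \<le> (K * (1 - cmod z) powr (- A)) powr p"
      using growth[OF z] p by (intro powr_mono2) auto
    also have "\<dots> = K powr p * (1 - cmod z) powr (- (p * A))"
      using K by (simp add: powr_mult powr_powr mult.commute)
    finally show "ennreal (cmod (f z) powr p) \<le> ennreal (K powr p) * ennreal ((1 - cmod z) powr (- (p * A)))"
      by (simp add: ennreal_leI flip: ennreal_mult)
  qed
  also have "\<dots> = ennreal (K powr p) * (\<integral>\<^sup>+ z. ennreal ((1 - cmod z) powr (- (p * A))) \<partial>area_measure)"
    by (intro nn_integral_cmult borel_measurable_area_measure) measurable
  also have "\<dots> < \<infinity>"
    using nn_integral_boundary_distance_powr[of "p * A"] p A by (auto simp: ennreal_mult_less_top)
  finally show ?thesis unfolding bergman_norm_less_infinity_iff .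
qed

section \<open>Koebe transforms and the second coefficient\<close>

text \<open>Makes membership checkable on a given representation. The existential normalization can
  be read off any pair: \<open>f\<close> determines \<open>h 0\<close>, which is \<open>f 0\<close>
  because \<open>g 0 = 0\<close>, and \<open>deriv h 0\<close>, which is
  \<open>wirtinger_z f 0\<close>.\<close>

lemma canonical_rep_S_H_iff:
  assumes rep: "canonical_rep f h g"
  shows "f \<in> S_H \<longleftrightarrow>
    inj_on f \<DD> \<and> (\<forall>z\<in>\<DD>. cmod (deriv g z) < cmod (deriv h z)) \<and> h 0 = 0 \<and> deriv h 0 = 1"
proof -
  have "harmonic_on \<DD> f"
    using rep unfolding canonical_rep_def by (intro harmonic_on_holomorphic_plus_cnj) auto
  moreover have "sense_preserving_on \<DD> f \<longleftrightarrow> (\<forall>z\<in>\<DD>. cmod (deriv g z) < cmod (deriv h z))"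
    unfolding sense_preserving_on_def
    using canonical_rep_wirtinger[OF rep] by (intro ball_cong) (auto simp: abs_le_square_iff[symmetric] not_le[symmetric])
  moreover have "(\<exists>h g. canonical_rep f h g \<and> h 0 = 0 \<and> deriv h 0 = 1) \<longleftrightarrow> h 0 = 0 \<and> deriv h 0 = 1"
  proof -
    have "h1 0 = h 0 \<and> deriv h1 0 = deriv h 0" if "canonical_rep f h1 g1" for h1 g1
      using rep that canonical_rep_wirtinger(1)[OF rep, of 0] canonical_rep_wirtinger(1)[OF that, of 0]
      by (auto simp: canonical_rep_def dest!: bspec[where x = "0 :: complex"])
    then show ?thesis using rep by metis
  qed
  ultimately show ?thesis by (auto simp: S_H_def)
qed

text \<open>Moving \<open>a\<close> to the origin by a disk automorphism and renormalizing keeps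
  injectivity and the sign of the Jacobian. The second coefficient then carries
  \<open>h''/h'\<close> at \<open>a\<close>, with the correction \<open>- 2 * cnj a\<close> coming
  from the second derivative of the automorphism.\<close>

lemma koebe_transform:
  fixes f h g :: "complex \<Rightarrow> complex"
  assumes rep: "canonical_rep f h g" and f: "f \<in> S_H" and a: "a \<in> \<DD>"
  obtains F H G where "F \<in> S_H" "canonical_rep F H G"
    "deriv (deriv H) 0 = (1 - (cmod a)\<^sup>2) * deriv (deriv h) a / deriv h a - 2 * cnj a"
proof -
  have h: "h holomorphic_on \<DD>" and g: "g holomorphic_on \<DD>"
    and fhg: "\<And>z. z \<in> \<DD> \<Longrightarrow> f z = h z + cnj (g z)"
    using rep by (auto simp: canonical_rep_def)
  have inj: "inj_on f \<DD>" and jac: "\<And>z. z \<in> \<DD> \<Longrightarrow> cmod (deriv g z) < cmod (deriv h z)"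
    using f canonical_rep_S_H_iff[OF rep] by auto
  have h'a: "deriv h a \<noteq> 0" using jac[OF a] by auto
  define w where "w = (1 - (cmod a)\<^sup>2)"
  have w: "w > 0" using a by (simp add: w_def abs_square_less_1)
  define \<phi> where "\<phi> = Moebius_function 0 (- a)"
  have \<phi>_eq: "\<phi> z = (z + a) / (1 + cnj a * z)" for z
    by (simp add: \<phi>_def Moebius_function_simple)
  have \<phi>_disk: "\<phi> z \<in> \<DD>" if "z \<in> \<DD>" for z
    using Moebius_function_norm_lt_1[of "- a" z 0] a that by (simp add: \<phi>_def)
  \<comment> \<open>A left inverse on the disk: it makes \<phi> injective there, and hence
    \<open>F\<close> as well.\<close>
  have \<phi>_inv: "Moebius_function 0 a (\<phi> z) = z" if "z \<in> \<DD>" for z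
    using Moebius_function_compose[of a "- a" z] a that by (simp add: \<phi>_def)
  have \<phi>_0: "\<phi> 0 = a" by (simp add: \<phi>_eq)
  have \<phi>_hol: "\<phi> holomorphic_on \<DD>"
    unfolding \<phi>_def using a by (intro Moebius_function_holomorphic) simp
  have den: "1 + cnj a * z \<noteq> 0" if "z \<in> \<DD>" for z
  proof
    assume "1 + cnj a * z = 0"
    then have "cnj a * z = - 1" by (simp add: add_eq_0_iff)
    then have "cmod a * cmod z = 1" by (metis complex_mod_cnj norm_minus_cancel norm_mult norm_one)
    moreover have "cmod a * cmod z < 1 * 1"
      using a that by (intro mult_strict_mono') auto
    ultimately show False by simp
  qed
  have \<phi>': "(\<phi> has_field_derivative w / (1 + cnj a * z)\<^sup>2) (at z)" if "z \<in> \<DD>" for z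
  proof -
    have "of_real w = 1 - a * cnj a" by (simp add: w_def flip: complex_norm_square)
    then show ?thesis
      unfolding \<phi>_eq[abs_def] using den[OF that]
      by (auto intro!: derivative_eq_intros simp: power2_eq_square field_simps)
  qed
  \<comment> \<open>The derivative of \<open>h\<close> composed with \<phi> at 0; dividing by it
    gives \<open>deriv H 0 = 1\<close>.\<close>
  define c where "c = w * deriv h a"
  have c: "c \<noteq> 0" using w h'a by (simp add: c_def)
  define H where "H = (\<lambda>z. (h (\<phi> z) - h a) / c)"
  \<comment> \<open>Conjugating \<open>G\<close> in \<open>F\<close> turns the denominator
    \<open>cnj c\<close> into \<open>c\<close>, so that \<open>F\<close> is an affine image of
    \<open>f\<close> composed with \<phi>.\<close>
  define G where "G = (\<lambda>z. (g (\<phi> z) - g a) / cnj c)"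
  define F where "F = (\<lambda>z. H z + cnj (G z))"
  have comp: "((\<lambda>z. (k (\<phi> z) - k a) / d) has_field_derivative
      deriv k (\<phi> z) * (w / (1 + cnj a * z)\<^sup>2) / d) (at z)"
    if "z \<in> \<DD>" "k holomorphic_on \<DD>" for k d z
    using DERIV_cdivide[OF DERIV_diff[OF DERIV_chain2[OF
          holomorphic_derivI[OF that(2) open_ball \<phi>_disk[OF that(1)]] \<phi>'[OF that(1)]] DERIV_const], of "k a" d]
    by simp
  note H' = comp[OF _ h, of _ c, folded H_def]
  note G' = comp[OF _ g, of _ "cnj c", folded G_def]
  have rep': "canonical_rep F H G"
    unfolding canonical_rep_def
  proof (intro conjI ballI)
    show "H holomorphic_on \<DD>" "G holomorphic_on \<DD>"
      unfolding holomorphic_on_open[OF open_ball] using H' G' by blast+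
  qed (simp_all add: G_def F_def \<phi>_0)
  have F: "F \<in> S_H"
    unfolding canonical_rep_S_H_iff[OF rep']
  proof (intro conjI ballI)
    have "F z = (f (\<phi> z) - f a) / c" if "z \<in> \<DD>" for z
      using fhg[OF \<phi>_disk[OF that]] fhg[OF a] by (simp add: F_def H_def G_def diff_divide_distrib add_divide_distrib)
    then have "f (\<phi> x) = f (\<phi> y)" if "x \<in> \<DD>" "y \<in> \<DD>" "F x = F y" for x y
      using c that by simp
    then show "inj_on F \<DD>"
      using inj \<phi>_disk \<phi>_inv unfolding inj_on_def by metis
    show "H 0 = 0" by (simp add: H_def \<phi>_0)
    show "deriv H 0 = 1"
      using DERIV_imp_deriv[OF H'[of 0]] c by (simp add: \<phi>_0 c_def)
    fix z assume z: "z \<in> \<DD>"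
    \<comment> \<open>As \<open>c\<close> and \<open>cnj c\<close> have the same modulus, both
      derivatives acquire the same positive factor.\<close>
    have "cmod (deriv G z) = cmod (deriv g (\<phi> z)) * (cmod (w / (1 + cnj a * z)\<^sup>2) / cmod c)"
      by (simp add: DERIV_imp_deriv[OF G'[OF z]] norm_divide norm_mult)
    also have "\<dots> < cmod (deriv h (\<phi> z)) * (cmod (w / (1 + cnj a * z)\<^sup>2) / cmod c)"
      using jac[OF \<phi>_disk[OF z]] c w den[OF z] by (intro mult_strict_right_mono) auto
    also have "\<dots> = cmod (deriv H z)"
      by (simp add: DERIV_imp_deriv[OF H'[OF z]] norm_divide norm_mult)
    finally show "cmod (deriv G z) < cmod (deriv H z)" .
  qed
  have "(deriv H has_field_derivative w * deriv (deriv h) a / deriv h a - 2 * cnj a) (at 0)"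
  proof (rule has_field_derivative_transform_within_open)
    have "(deriv h has_field_derivative deriv (deriv h) a) (at (\<phi> 0))"
      unfolding \<phi>_0 using holomorphic_derivI[OF holomorphic_deriv[OF h] _ a] by simp
    from DERIV_chain2[OF this \<phi>'[of 0]]
    have "((\<lambda>z. deriv h (\<phi> z)) has_field_derivative deriv (deriv h) a * w) (at 0)" by simp
    then show "((\<lambda>z. deriv h (\<phi> z) * (w / (1 + cnj a * z)\<^sup>2) / c) has_field_derivative
        w * deriv (deriv h) a / deriv h a - 2 * cnj a) (at 0)"
      using c w h'a
      by (auto intro!: derivative_eq_intros simp: \<phi>_0 c_def field_simps power2_eq_square)
    show "deriv h (\<phi> z) * (w / (1 + cnj a * z)\<^sup>2) / c = deriv H z" if "z \<in> \<DD>" for z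
      using DERIV_imp_deriv[OF H'[OF that]] by simp
  qed auto
  then have "deriv (deriv H) 0 = w * deriv (deriv h) a / deriv h a - 2 * cnj a"
    by (rule DERIV_imp_deriv)
  with F rep' that show thesis by (simp add: w_def)
qed

lemma pre_schwarzian_bound:
  fixes f h g :: "complex \<Rightarrow> complex"
  assumes rep: "canonical_rep f h g" and f: "f \<in> S_H" and a: "a \<in> \<DD>"
    and A: "order_S_H \<le> ereal A"
  shows "cmod (deriv (deriv h) a / deriv h a) \<le> 2 * (A + cmod a) / (1 - (cmod a)\<^sup>2)"
proof -
  obtain F H G where FHG: "F \<in> S_H" "canonical_rep F H G"
    "deriv (deriv H) 0 = (1 - (cmod a)\<^sup>2) * deriv (deriv h) a / deriv h a - 2 * cnj a"
    using koebe_transform[OF rep f a] .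
  have "ereal (cmod (deriv (deriv H) 0 / 2)) \<le> order_S_H"
    unfolding order_S_H_def using FHG(1,2) by (intro Sup_upper) blast
  then have H: "cmod (deriv (deriv H) 0) \<le> 2 * A"
    using order_trans[OF _ A] by (fastforce simp: norm_divide)
  have w: "1 - (cmod a)\<^sup>2 > 0" using a by (simp add: abs_square_less_1)
  have "(1 - (cmod a)\<^sup>2) * cmod (deriv (deriv h) a / deriv h a)
      = cmod (of_real (1 - (cmod a)\<^sup>2) * (deriv (deriv h) a / deriv h a))"
    using w by (simp only: norm_mult norm_of_real abs_of_pos)
  also have "of_real (1 - (cmod a)\<^sup>2) * (deriv (deriv h) a / deriv h a) = deriv (deriv H) 0 + 2 * cnj a"
    using FHG(3) by simp
  also have "cmod \<dots> \<le> 2 * A + 2 * cmod a"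
    using H norm_triangle_ineq[of "deriv (deriv H) 0" "2 * cnj a"] by (simp add: norm_mult)
  finally show ?thesis using w by (simp add: field_simps)
qed

section \<open>Distortion and growth in terms of the order\<close>

text \<open>A supremum over the empty set would be minus infinity; the member \<open>f\<close>
  excludes this.\<close>

lemma order_S_H_nonneg:
  assumes "f \<in> S_H"
  shows "0 \<le> order_S_H"
proof -
  obtain h g where "canonical_rep f h g" using assms by (auto simp: S_H_def)
  then have "ereal (cmod (deriv (deriv h) 0 / 2)) \<le> order_S_H"
    unfolding order_S_H_def using assms by (intro Sup_upper) blast
  moreover have "0 \<le> ereal (cmod (deriv (deriv h) 0 / 2))" by simp
  ultimately show ?thesis by (rule order_trans[rotated])
qed

lemma order_S_H_finite:
  assumes "f \<in> S_H" "order_S_H \<noteq> \<infinity>"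
  obtains a where "order_S_H = ereal a" "0 \<le> a"
proof (cases order_S_H)
  case (real a)
  moreover have "0 \<le> a" using order_S_H_nonneg[OF assms(1)] unfolding real by simp
  ultimately show thesis using that by blast
qed (use assms order_S_H_nonneg[OF assms(1)] in auto)

text \<open>A holomorphic logarithm \<open>L\<close> of the nonvanishing \<open>deriv h\<close> has
  the derivative \<open>h''/h'\<close>. Integrating its bound along the radius controls
  \<open>Re L\<close>, hence the modulus of \<open>deriv h\<close>.\<close>

lemma distortion:
  fixes f h g :: "complex \<Rightarrow> complex"
  assumes rep: "canonical_rep f h g" and f: "f \<in> S_H"
    and A: "order_S_H \<le> ereal A" "0 \<le> A" and z: "z \<in> \<DD>"
  shows "cmod (deriv h z) \<le> exp A * (1 - cmod z) powr (- (A + 1))"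
proof -
  have h: "h holomorphic_on \<DD>" using rep by (simp add: canonical_rep_def)
  have h': "deriv h holomorphic_on \<DD>" using h by (rule holomorphic_deriv) simp
  have nz: "deriv h z \<noteq> 0" if "z \<in> \<DD>" for z
    using f that unfolding canonical_rep_S_H_iff[OF rep] by fastforce
  obtain L where L: "L holomorphic_on \<DD>" and hL: "\<And>z. z \<in> \<DD> \<Longrightarrow> deriv h z = exp (L z)"
    using contractible_imp_holomorphic_log[OF h' convex_imp_contractible[OF convex_ball] nz] by blast
  have L': "deriv L z = deriv (deriv h) z / deriv h z" if "z \<in> \<DD>" for z
  proof -
    have "((\<lambda>z. exp (L z)) has_field_derivative exp (L z) * deriv L z) (at z)"
      using holomorphic_derivI[OF L _ that] by (auto intro!: derivative_eq_intros)
    then have "(deriv h has_field_derivative exp (L z) * deriv L z) (at z)"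
      by (rule has_field_derivative_transform_within_open[of _ _ _ \<DD>]) (use that hL in auto)
    then show ?thesis using hL[OF that] by (simp add: DERIV_imp_deriv)
  qed
  have "cmod (L z - L 0) \<le> (A * cmod z - (A + 1) * ln (1 - cmod z)) - (A * 0 - (A + 1) * ln (1 - 0))"
  proof (rule disk_radial_bound[OF L _ _ z])
    fix t :: real assume t: "0 \<le> t" "t < 1"
    then show "((\<lambda>t. A * t - (A + 1) * ln (1 - t)) has_real_derivative A + (A + 1) / (1 - t)) (at t)"
      by (auto intro!: derivative_eq_intros)
  next
    fix a :: complex assume a: "a \<in> \<DD>"
    define t where "t = cmod a"
    have t: "0 \<le> t" "t < 1" using a by (auto simp: t_def)
    \<comment> \<open>In partial fractions \<open>2 * (A + t) / (1 - t\<^sup>2)\<close> is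
      \<open>(A + 1) / (1 - t) + (A - 1) / (1 + t)\<close>, and the second fraction is at most
      \<open>A\<close>.\<close>
    have "2 * (A + t) = (A * (1 + t) + (A + 1) * (1 + t)) - (1 + t) * A + (A - 1) * (1 - t)"
      by (simp add: algebra_simps)
    also have "\<dots> \<le> A * (1 - t\<^sup>2) + (A + 1) * (1 + t)"
    proof -
      have "A * (1 - t) \<le> A * ((1 + t) * (1 - t))"
        using A(2) t by (intro mult_left_mono) (auto simp: mult_le_cancel_right1)
      then show ?thesis using t by (simp add: algebra_simps power2_eq_square)
    qed
    finally have "2 * (A + t) / (1 - t\<^sup>2) \<le> (A * (1 - t\<^sup>2) + (A + 1) * (1 + t)) / (1 - t\<^sup>2)"
      using t by (intro divide_right_mono) (auto simp: power_le_one)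
    also have "\<dots> = A + (A + 1) / (1 - t)"
    proof -
      have "1 - t\<^sup>2 = (1 + t) * (1 - t)" by (simp add: algebra_simps power2_eq_square)
      then show ?thesis using t by (simp add: add_divide_distrib)
    qed
    finally show "cmod (deriv L a) \<le> A + (A + 1) / (1 - cmod a)"
      using pre_schwarzian_bound[OF rep f a A(1)] L'[OF a] by (simp add: t_def)
  qed
  \<comment> \<open>The term \<open>A * cmod z\<close> is bounded by \<open>A\<close> and becomes
    the constant factor \<open>exp A\<close>.\<close>
  then have le: "cmod (L z - L 0) \<le> A - (A + 1) * ln (1 - cmod z)"
    using A(2) z mult_left_le[of "cmod z" A] by simp
  \<comment> \<open>The branch of the logarithm is arbitrary, but \<open>deriv h 0 = 1\<close> makes
    subtracting \<open>L 0\<close> harmless after exponentiation.\<close>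
  have "exp (L 0) = 1"
    using hL[of 0] f canonical_rep_S_H_iff[OF rep] by simp
  then have "cmod (deriv h z) = exp (Re (L z - L 0))"
    using hL[OF z] by (simp add: exp_diff flip: norm_exp_eq_Re)
  also have "\<dots> \<le> exp (A - (A + 1) * ln (1 - cmod z))"
    using le complex_Re_le_cmod[of "L z - L 0"] by simp
  also have "\<dots> = exp A * (1 - cmod z) powr (- (A + 1))"
    using z by (simp add: powr_def algebra_simps flip: exp_add)
  finally show ?thesis .
qed

text \<open>For \<open>A > 0\<close> the function \<open>K / A * (1 - t) powr (- A)\<close> is a
  primitive of the radial bound; its value at 0 enters with a minus sign and is dropped.\<close>

lemma growth_of_derivative_bound:
  assumes k: "k holomorphic_on \<DD>" "k 0 = 0" and A: "0 < A"
    and bound: "\<And>z. z \<in> \<DD> \<Longrightarrow> cmod (deriv k z) \<le> K * (1 - cmod z) powr (- (A + 1))"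
    and K: "0 \<le> K" and z: "z \<in> \<DD>"
  shows "cmod (k z) \<le> K / A * (1 - cmod z) powr (- A)"
proof -
  have "cmod (k z - k 0) \<le> K / A * (1 - cmod z) powr (- A) - K / A * (1 - 0) powr (- A)"
  proof (rule disk_radial_bound[OF k(1) _ bound z])
    fix t :: real assume "0 \<le> t" "t < 1"
    then show "((\<lambda>t. K / A * (1 - t) powr (- A)) has_real_derivative K * (1 - t) powr (- (A + 1))) (at t)"
      using A by (auto intro!: derivative_eq_intros simp: powr_diff powr_minus powr_add field_simps)
  qed
  also have "\<dots> \<le> K / A * (1 - cmod z) powr (- A)" using K A by simp
  finally show ?thesis using k by simp
qed

theorem theorem2:
  fixes f :: "complex \<Rightarrow> complex" and \<alpha> :: ereal
  defines "\<alpha> \<equiv> order_S_H"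
  assumes "f \<in> S_H"
  shows "(\<forall>p::real. 0 < p \<and> ereal p < 1 / \<alpha> \<longrightarrow> f \<in> harmonic_bergman p) \<and>
    (\<forall>q::real. 0 < q \<and> ereal q < 1 / (\<alpha> + 1) \<longrightarrow>
       wirtinger_z f \<in> bergman q \<and>
       (\<lambda>z. cnj (wirtinger_zbar f z)) \<in> bergman q \<and>
       partial_theta f \<in> harmonic_bergman q \<and>
       (\<lambda>z. complex_of_real (cmod z) * partial_r f z) \<in> harmonic_bergman q)"
proof -
  note f = \<open>f \<in> S_H\<close>
  obtain h g where rep: "canonical_rep f h g" using f by (auto simp: S_H_def)
  have h: "h holomorphic_on \<DD>" and g: "g holomorphic_on \<DD>" and g0: "g 0 = 0"
    and fhg: "\<And>z. z \<in> \<DD> \<Longrightarrow> f z = h z + cnj (g z)"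
    using rep by (auto simp: canonical_rep_def)
  have h': "deriv h holomorphic_on \<DD>" and g': "deriv g holomorphic_on \<DD>"
    by (rule holomorphic_deriv[OF h open_ball] holomorphic_deriv[OF g open_ball])+
  have h0: "h 0 = 0" and jac: "\<And>z. z \<in> \<DD> \<Longrightarrow> cmod (deriv g z) < cmod (deriv h z)"
    using f canonical_rep_S_H_iff[OF rep] by auto
  note dist_h = distortion[OF rep f]
  have dist_g: "cmod (deriv g z) \<le> exp A * (1 - cmod z) powr (- (A + 1))"
    if "order_S_H \<le> ereal A" "0 \<le> A" "z \<in> \<DD>" for A z
    using jac[OF that(3)] dist_h[OF that] by linarith
  have i: "f \<in> harmonic_bergman p" if p: "0 < p" "ereal p < 1 / \<alpha>" for p
  proof -
    \<comment> \<open>In the extended reals \<open>1 / \<infinity>\<close> is 0, so no positive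
      \<open>p\<close> would lie below it.\<close>
    have "order_S_H \<noteq> \<infinity>" using p by (auto simp: \<alpha>_def)
    then obtain a where a: "order_S_H = ereal a" "0 \<le> a" using order_S_H_finite[OF f] by metis
    \<comment> \<open>Replacing \<open>\<alpha>\<close> by something positive avoids the logarithmic growth at \<open>\<alpha> = 0\<close>.\<close>
    define A where "A = max a (1 / (2 * p))"
    have A: "0 < A" "order_S_H \<le> ereal A" using p by (auto simp: A_def a less_max_iff_disj)
    \<comment> \<open>The case \<open>a = 0\<close> is separate because \<open>1 / 0\<close> is
      infinite in the extended reals but 0 in the reals.\<close>
    have "p * a < 1"
    proof (cases "a = 0")
      case False
      then have "p < 1 / a" using p(2) unfolding \<alpha>_def a(1) by (simp add: one_ereal_def)
      with False a show ?thesis by (simp add: field_simps)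
    qed simp
    \<comment> \<open>If the maximum is \<open>1 / (2 * p)\<close>, the product is
      \<open>1 / 2\<close>; otherwise it is \<open>p * a\<close>.\<close>
    then have pA: "p * A < 1" using p by (simp add: A_def max_def)
    define K where "K = exp A / A"
    have "cmod (f z) \<le> (K + K) * (1 - cmod z) powr (- A)" if z: "z \<in> \<DD>" for z
    proof -
      have "cmod (h z) \<le> K * (1 - cmod z) powr (- A)" "cmod (g z) \<le> K * (1 - cmod z) powr (- A)"
        unfolding K_def using A(1) dist_h[OF A(2)] dist_g[OF A(2)]
        by (intro growth_of_derivative_bound[OF h h0 A(1) _ _ z]
            growth_of_derivative_bound[OF g g0 A(1) _ _ z]; simp)+
      then show ?thesis
        using norm_triangle_ineq[of "h z" "cnj (g z)"] fhg[OF z] by (simp add: algebra_simps)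
    qed
    then have "bergman_norm p f < \<infinity>"
      using p A pA by (intro bergman_norm_finite_if_growth[where A = A and K = "K + K"]) (auto simp: K_def)
    then show ?thesis using f by (simp add: harmonic_bergman_def S_H_def)
  qed
  have ii: "wirtinger_z f \<in> bergman q \<and> (\<lambda>z. cnj (wirtinger_zbar f z)) \<in> bergman q \<and>
      partial_theta f \<in> harmonic_bergman q \<and>
      (\<lambda>z. complex_of_real (cmod z) * partial_r f z) \<in> harmonic_bergman q"
    if q: "0 < q" "ereal q < 1 / (\<alpha> + 1)" for q
  proof -
    have "order_S_H \<noteq> \<infinity>" using q by (auto simp: \<alpha>_def)
    then obtain a where a: "order_S_H = ereal a" "0 \<le> a" using order_S_H_finite[OF f] by metis
    have "q < 1 / (a + 1)" using q(2) a(2) unfolding \<alpha>_def a(1) by (simp add: one_ereal_def)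
    then have qa: "q * (a + 1) < 1" using a by (simp add: field_simps)
    define B where "B z = exp a * (1 - cmod z) powr (- (a + 1))" for z
    have Bh: "cmod (deriv h z) \<le> B z" and Bg: "cmod (deriv g z) \<le> B z" if "z \<in> \<DD>" for z
      using dist_h[of a z] dist_g[of a z] a that by (auto simp: B_def)
    \<comment> \<open>Twice \<open>B\<close> accommodates the sum of an \<open>h\<close>-term and a
      \<open>g\<close>-term; the analytic functions satisfy it all the more.\<close>
    have fin: "bergman_norm q k < \<infinity>" if "\<And>z. z \<in> \<DD> \<Longrightarrow> cmod (k z) \<le> B z + B z" for k
      using q a qa that
      by (intro bergman_norm_finite_if_growth[where A = "a + 1" and K = "2 * exp a"])
        (auto simp: B_def mult.assoc)
    have B0: "0 \<le> B z" for z by (simp add: B_def)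
    \<comment> \<open>The angular derivative has this form with \<open>c = \<i>\<close>, and the
      radial one multiplied by \<open>cmod z\<close> with \<open>c = 1\<close>.\<close>
    have polar: "k \<in> harmonic_bergman q"
      if k: "\<And>z. z \<in> \<DD> \<Longrightarrow> k z = c * z * deriv h z + cnj (c * z * deriv g z)" and c: "cmod c = 1" for k c
    proof -
      have "harmonic_on \<DD> k"
        by (rule harmonic_on_holomorphic_plus_cnj[OF open_ball _ _ k]) (auto intro!: holomorphic_intros h' g')
      moreover have "cmod (k z) \<le> B z + B z" if z: "z \<in> \<DD>" for z
      proof -
        have "cmod (c * z * k') \<le> B z" if "cmod k' \<le> B z" for k'
          using that z c mult_mono[of "cmod z" 1 "cmod k'" "B z"] by (simp add: norm_mult)
        from this[OF Bh[OF z]] this[OF Bg[OF z]] show ?thesis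
          unfolding k[OF z] using norm_triangle_ineq[of "c * z * deriv h z" "cnj (c * z * deriv g z)"]
            complex_mod_cnj[of "c * z * deriv g z"] by linarith
      qed
      ultimately show ?thesis using fin by (simp add: harmonic_bergman_def)
    qed
    \<comment> \<open>The Wirtinger derivatives are identified with \<open>deriv h\<close> and
      \<open>cnj (deriv g z)\<close> on the disk only, so holomorphy and the bound are transferred
      from there.\<close>
    have analytic: "k \<in> bergman q"
      if "k' holomorphic_on \<DD>" "\<And>z. z \<in> \<DD> \<Longrightarrow> k z = k' z" "\<And>z. z \<in> \<DD> \<Longrightarrow> cmod (k' z) \<le> B z" for k k'
      unfolding bergman_def mem_Collect_eq
    proof
      show "k holomorphic_on \<DD>" by (rule holomorphic_transform[OF that(1)]) (simp add: that(2))
      show "bergman_norm q k < \<infinity>"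
        using that(2,3) B0 by (intro fin) (metis add_increasing2)
    qed
    have "wirtinger_z f \<in> bergman q"
      using h' canonical_rep_wirtinger(1)[OF rep] Bh by (rule analytic)
    moreover have "(\<lambda>z. cnj (wirtinger_zbar f z)) \<in> bergman q"
      by (rule analytic[OF g' _ Bg]) (simp_all add: canonical_rep_wirtinger(2)[OF rep])
    moreover have "partial_theta f \<in> harmonic_bergman q"
      using canonical_rep_partial_theta[OF rep] by (intro polar[where c = \<i>]) auto
    moreover have "(\<lambda>z. complex_of_real (cmod z) * partial_r f z) \<in> harmonic_bergman q"
      using canonical_rep_partial_r[OF rep] by (intro polar[where c = 1]) auto
    ultimately show ?thesis by blast
  qed
  show ?thesis using i ii by blast
qed

end
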